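(* Let $m\ge2$ be an even integer and $k=\frac{m+2}{2}$. Then $C_{\frac{m-2}{2}}(\Sigma_m)$ is a triangulated set, i.e. $C_{\frac{m-2}{2}}(\Sigma_m)=\overline{T}_m$, and the incidence matrix associated to the triangulation $\overline{T}_m$ satisfies $\mathcal{L}_k=A_k^{k-3}$.
   Context: $C^a_b$ denotes the binomial coefficient. $I(\ell,m)=\{(\alpha_1,\ldots,\alpha_\ell)\in\mathbb{N}^\ell:1\le\alpha_1<\cdots<\alpha_\ell\le m\}$. Triangulations: for $m$ even let $P_i=(i,2m-i+1)$ for $1\le i\le m$, $\Sigma_m=\{P_1,\ldots,P_m\}$ and $\Sigma_{[s,m]}=\{P_{s+1},\ldots,P_m\}$. For a finite set $\Sigma$ of such $P_i$, $C_s(\Sigma)$ is the set of combinations of $s$ elements of $\Sigma$, written as tuples $(P_{\alpha_1},\ldots,P_{\alpha_s})$ with increasing indices. For $m\ge8$ even and $\alpha=(\alpha(1),\ldots,\alpha(\frac{m-6}{2}))\in I(\frac{m-6}{2},m-2)$ let $T_\alpha=\{(P_{\alpha(1)},\ldots,P_{\alpha((m-6)/2)})\}\times C_2(\Sigma_{[\alpha((m-6)/2),m]})$ (tuples being concatenated), and let $T_m=\bigcup_{\alpha\in I((m-6)/2,\,m-2)}T_\alpha$. Put $\overline{T}_2=C_0(\Sigma_2)$, $\overline{T}_4=C_1(\Sigma_4)$, $\overline{T}_6=C_2(\Sigma_6)$, and $\overline{T}_m=T_m$ for $m\ge8$ even. Incidence matrix: identify $\beta\in I(m/2,m)$ with the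 combination $(P_{\beta_1},\ldots,P_{\beta_{m/2}})$. Define $\varphi^m:\overline{T}_m\to\{0,1\}^{I(m/2,m)}$ by letting the $\beta$-coordinate of $\varphi^m(P_{\alpha(1)},\ldots,P_{\alpha((m-2)/2)})$ be $1$ if $\beta$ is, up to reordering, of the form $(P_{\alpha(1)},\ldots,P_{\alpha((m-2)/2)},P_i)$ for some $P_i\in\Sigma_m$ with $|\mathrm{supp}(P_{\alpha(1)},\ldots,P_{\alpha((m-2)/2)},P_i)|=m$, and $0$ otherwise; here the support of a tuple of $P_j$'s is the set of all integers $j,\,2m-j+1$ occurring in it. $\mathcal{L}_k=\varphi^m(\overline{T}_m)$ is the $|\overline{T}_m|\times C^m_{m/2}$ matrix whose rows are the vectors $\varphi^m(t)$, $t\in\overline{T}_m$; rows and columns are ordered lexicographically by their index tuples. Matrices $A_k^j$: $I_p$ is the identity matrix; $X(Y)$ is the matrix obtained by pasting $Y$ below $X$; $X\sqcup Y$ is obtained by placing $Y$ to the right of $X$ with bottom rows aligned and filling the remaining upper right block with zeros (iterated from left to right). $A_k^{-1}$ is the $1\times k$ all-ones row and, for $j\ge0$, $A_k^{j}=A_k^{j-1}(I_{C^{k+j}_{j+1}})\sqcup A_{k-1}^{j-1}(I_{C^{k-1+j}_{j+1}})\sqcup\cdots\sqcup A_1^{j-1}(I_{C^{1+j}_{j+1}})$. *)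

theory Defs
  imports "HOL-Library.List_Lexorder" "HOL-Library.Multiset" "Jordan_Normal_Form.Matrix"
begin

section \<open>Triangulations\<close>

definition incr_tuples :: "nat \<Rightarrow> nat \<Rightarrow> nat list set" where
  "incr_tuples l m = {\<alpha>. length \<alpha> = l \<and> set \<alpha> \<subseteq> {1..m} \<and> sorted_wrt (<) \<alpha>}"

definition pt :: "nat \<Rightarrow> nat \<Rightarrow> nat \<times> nat" where
  "pt m i = (i, 2 * m - i + 1)"

definition Sig :: "nat \<Rightarrow> (nat \<times> nat) set" where
  "Sig m = pt m ` {1..m}"

definition Sig_seg :: "nat \<Rightarrow> nat \<Rightarrow> (nat \<times> nat) set" where
  "Sig_seg s m = pt m ` {s+1..m}"

text \<open>The index of a point \<open>pt m i\<close> is its first component.\<close>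

definition combs :: "nat \<Rightarrow> (nat \<times> nat) set \<Rightarrow> (nat \<times> nat) list set" where
  "combs s S = {t. length t = s \<and> set t \<subseteq> S \<and> sorted_wrt (<) (map fst t)}"

definition T_part :: "nat \<Rightarrow> nat list \<Rightarrow> (nat \<times> nat) list set" where
  "T_part m \<alpha> = {map (pt m) \<alpha> @ c | c. c \<in> combs 2 (Sig_seg (last \<alpha>) m)}"

definition T_union :: "nat \<Rightarrow> (nat \<times> nat) list set" where
  "T_union m = (\<Union>\<alpha> \<in> incr_tuples ((m - 6) div 2) (m - 2). T_part m \<alpha>)"

text \<open>Only even \<open>m \<ge> 2\<close> is meaningful here.\<close>

definition Tbar :: "nat \<Rightarrow> (nat \<times> nat) list set" where
  "Tbar m =
    (if m = 2 then combs 0 (Sig 2)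
     else if m = 4 then combs 1 (Sig 4)
     else if m = 6 then combs 2 (Sig 6)
     else T_union m)"

section \<open>The incidence matrix\<close>

definition supp :: "(nat \<times> nat) list \<Rightarrow> nat set" where
  "supp t = fst ` set t \<union> snd ` set t"

text \<open>Equality of multisets expresses the phrase ``up to reordering''.\<close>

definition phi :: "nat \<Rightarrow> (nat \<times> nat) list \<Rightarrow> nat list \<Rightarrow> int" where
  "phi m t \<beta> =
    (if \<exists>p \<in> Sig m. mset (map (pt m) \<beta>) = mset (t @ [p]) \<and> card (supp (t @ [p])) = m
     then 1 else 0)"

text \<open>
  Rows and columns are enumerated in the lexicographic order of their index tuples,
  which is the order on \<^typ>\<open>nat list\<close> provided by \<^theory>\<open>HOL-Library.List_Lexorder\<close>.
\<close>

definition incidence_matrix :: "nat \<Rightarrow> (nat \<times> nat) list set \<Rightarrow> int mat" where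
  "incidence_matrix m S =
    (let rows = sorted_key_list_of_set (map fst) S;
         cols = sorted_list_of_set (incr_tuples (m div 2) m)
     in mat (length rows) (length cols) (\<lambda>(r, c). phi m (rows ! r) (cols ! c)))"

text \<open>The index is \<open>k = (m + 2) / 2\<close>, so \<open>m = 2 * k - 2\<close>.\<close>

definition L_mat :: "nat \<Rightarrow> int mat" where
  "L_mat k = incidence_matrix (2 * k - 2) (Tbar (2 * k - 2))"

section \<open>The matrices \<open>A\<^sub>k\<^sup>j\<close>\<close>

text \<open>
  \<open>X \<squnion> Y\<close> is only meaningful if \<open>Y\<close> has at most as many rows as \<open>X\<close>.
  Pasting \<open>Y\<close> below \<open>X\<close> is the library's \<open>X @\<^sub>r Y\<close>.
\<close>

definition bottom_join :: "int mat \<Rightarrow> int mat \<Rightarrow> int mat"  (infixl "\<squnion>" 65) where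
  "X \<squnion> Y = (let d = dim_row X - dim_row Y in
     mat (dim_row X) (dim_col X + dim_col Y) (\<lambda>(r, c).
       if c < dim_col X then X $$ (r, c)
       else if r < d then 0
       else Y $$ (r - d, c - dim_col X)))"

text \<open>
  The upper index is shifted by one to start the recursion at \<open>0\<close>:
  \<open>A_shift j k\<close> is $A_k^{j-1}$, for \<open>k \<ge> 1\<close>. The list \<open>rev [1..<k]\<close> is \<open>k - 1, \<dots>, 1\<close>.
\<close>

primrec A_shift :: "nat \<Rightarrow> nat \<Rightarrow> int mat" where
  "A_shift 0 k = mat 1 k (\<lambda>_. 1)"
| "A_shift (Suc j) k =
    (let B = (\<lambda>i. A_shift j i @\<^sub>r 1\<^sub>m ((i + j) choose (j + 1)))
     in foldl (\<squnion>) (B k) (map B (rev [1..<k])))"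

definition A_mat :: "nat \<Rightarrow> int \<Rightarrow> int mat" where
  "A_mat k j = A_shift (nat (j + 1)) k"

end

theory Submission
  imports Defs
begin

text \<open>
  Up to the encoding of points, both index sets consist of increasing tuples in \<open>{1..m}\<close>, and the
  incidence matrix is the inclusion matrix of \<open>j\<close>-subsets against \<open>(j + 1)\<close>-subsets in
  lexicographic order: the support condition only says that the added point is new, since the two
  coordinates of \<open>P\<^sub>i\<close> lie on different sides of \<open>m\<close>. Splitting subsets
  according to whether they contain the least element cuts the inclusion matrix into four blocks,
  and these blocks are exactly the recursion that defines the matrices \<open>A\<^sub>k\<^sup>j\<close>.
\<close>

section \<open>Lexicographic enumeration of combinations\<close>

text \<open>Tuples using the head come first, so the blocks of the inclusion matrix are contiguous
  index ranges. The list of letters is arbitrary so that inductions can pass to its tail.\<close>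

fun lex_combs :: "nat \<Rightarrow> 'a list \<Rightarrow> 'a list list" where
  "lex_combs 0 xs = [[]]"
| "lex_combs (Suc l) [] = []"
| "lex_combs (Suc l) (x # xs) = map ((#) x) (lex_combs l xs) @ lex_combs (Suc l) xs"

lemma length_lex_combs: "length (lex_combs l xs) = length xs choose l"
  by (induction l xs rule: lex_combs.induct) auto

lemma set_lex_combs:
  fixes xs :: "'a::linorder list"
  assumes "sorted_wrt (<) xs"
  shows "set (lex_combs l xs) = {ys. length ys = l \<and> set ys \<subseteq> set xs \<and> sorted_wrt (<) ys}"
  using assms
proof (induction l xs rule: lex_combs.induct)
  case (1 xs)
  show ?case by auto
next
  case (2 l)
  show ?case by auto
next
  case (3 l x xs)
  have IH: "set (lex_combs l xs) = {ys. length ys = l \<and> set ys \<subseteq> set xs \<and> sorted_wrt (<) ys}"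
    "set (lex_combs (Suc l) xs) = {ys. length ys = Suc l \<and> set ys \<subseteq> set xs \<and> sorted_wrt (<) ys}"
    using 3 by auto
  have x: "x < z" if "z \<in> set xs" for z using 3 that by auto
  show ?case
  proof (intro subset_antisym subsetI)
    fix ys assume "ys \<in> set (lex_combs (Suc l) (x # xs))"
    then show "ys \<in> {ys. length ys = Suc l \<and> set ys \<subseteq> set (x # xs) \<and> sorted_wrt (<) ys}"
      using x unfolding lex_combs.simps set_append set_map IH by fastforce
  next
    fix ys assume "ys \<in> {ys. length ys = Suc l \<and> set ys \<subseteq> set (x # xs) \<and> sorted_wrt (<) ys}"
    then obtain z zs where ys: "ys = z # zs" "length zs = l" "z \<in> insert x (set xs)"
      "set zs \<subseteq> insert x (set xs)" "sorted_wrt (<) zs" "\<forall>w\<in>set zs. z < w"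
      by (cases ys) auto
    \<comment> \<open>All later entries exceed \<open>z\<close>, hence \<open>x\<close>; so
      \<open>x\<close> can occur only as the head.\<close>
    have "z \<ge> x" using ys(3) x by force
    then have "set zs \<subseteq> set xs" using ys(4,6) by force
    then show "ys \<in> set (lex_combs (Suc l) (x # xs))"
      using ys x by (cases "z = x") (auto simp: IH)
  qed
qed

lemma sorted_lex_combs:
  fixes xs :: "'a::linorder list"
  assumes "sorted_wrt (<) xs"
  shows "sorted_wrt (<) (lex_combs l xs)"
  using assms
proof (induction l xs rule: lex_combs.induct)
  case (3 l x xs)
  have "x # a < b" if "a \<in> set (lex_combs l xs)" "b \<in> set (lex_combs (Suc l) xs)" for a b
    using that 3(3) by (cases b) (auto simp: set_lex_combs list_less_def)
  moreover have "sorted_wrt (<) (map ((#) x) (lex_combs l xs))"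
    using 3 by (auto simp: sorted_wrt_map)
  ultimately show ?case using 3 by (auto simp: sorted_wrt_append)
qed auto

text \<open>
  The locale facts about \<^const>\<open>sorted_key_list_of_set\<close> speak about the constant
  \<^term>\<open>linorder.sorted_key_list_of_set (\<le>)\<close>, which is not syntactically the class constant.
\<close>

lemma sorted_key_list_of_set_eq:
  fixes f :: "'b \<Rightarrow> 'a::linorder"
  assumes "sorted_wrt (<) (map f xs)"
  shows "sorted_key_list_of_set f (set xs) = xs"
proof -
  have xs: "sorted (map f xs)" "distinct xs" "inj_on f (set xs)"
    using assms by (auto simp: strict_sorted_iff distinct_map)
  interpret folding_insort_key "(\<le>)" "(<)" "set xs" f
    using xs by unfold_locales
  have "linorder.insort_key (\<le>) f x ys = insort_key f x ys" for x ys
    by (induction ys) (auto simp: linorder.insort_key.simps[OF linorder_class.linorder_axioms])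
  then have "linorder.insort_key (\<le>) f = insort_key f" by blast
  then have "linorder.sorted_key_list_of_set (\<le>) f = sorted_key_list_of_set f"
    by (simp add: sorted_key_list_of_set_def
        linorder.sorted_key_list_of_set_def[OF linorder_class.linorder_axioms])
  then show ?thesis using idem_if_sorted_distinct[OF subset_refl xs(1,2)] by simp
qed

section \<open>Inclusion matrices and the matrices \<open>A\<^sub>k\<^sup>j\<close>\<close>

definition inclusion_mat :: "'a list list \<Rightarrow> 'a list list \<Rightarrow> int mat" where
  "inclusion_mat R C = mat (length R) (length C)
     (\<lambda>(r, c). if set (R ! r) \<subseteq> set (C ! c) then 1 else 0)"

lemma dim_inclusion_mat [simp]:
  "dim_row (inclusion_mat R C) = length R" "dim_col (inclusion_mat R C) = length C"
  by (auto simp: inclusion_mat_def)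

lemma dim_bottom_join [simp]:
  "dim_row (X \<squnion> Y) = dim_row X" "dim_col (X \<squnion> Y) = dim_col X + dim_col Y"
  by (auto simp: bottom_join_def Let_def)

text \<open>The height bounds keep the natural-number subtractions exact: the two zero paddings add
  up to \<open>dim_row X - dim_row Z\<close>.\<close>

lemma bottom_join_assoc:
  assumes "dim_row Z \<le> dim_row Y" "dim_row Y \<le> dim_row X"
  shows "X \<squnion> Y \<squnion> Z = X \<squnion> (Y \<squnion> Z)"
  using assms by (intro eq_matI) (auto simp: bottom_join_def Let_def diff_diff_eq)

lemma foldl_bottom_join:
  assumes "dim_row Y \<le> dim_row X" "\<forall>Z\<in>set Zs. dim_row Z \<le> dim_row Y"
  shows "foldl (\<squnion>) (X \<squnion> Y) Zs = X \<squnion> foldl (\<squnion>) Y Zs"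
  using assms by (induction Zs arbitrary: Y) (auto simp: bottom_join_assoc)

lemma dim_row_foldl_bottom_join: "dim_row (foldl (\<squnion>) X Zs) = dim_row X"
  by (induction Zs arbitrary: X) auto

lemma dim_append_rows [simp]:
  "dim_row (A @\<^sub>r B) = dim_row A + dim_row B" "dim_col (A @\<^sub>r B) = dim_col A"
  by (auto simp: append_rows_def)

lemma dim_row_A_shift: "dim_row (A_shift j k) = (k + j) choose j"
proof (induction j arbitrary: k)
  case (Suc j)
  show ?case by (simp add: Let_def dim_row_foldl_bottom_join Suc)
qed simp

text \<open>Although \<open>k = 0\<close> is outside the intended range, a matrix without columns is
  neutral on the right of \<open>\<squnion>\<close>, so inductions on \<open>k\<close> can start
  there.\<close>

lemma dim_col_A_shift_0: "dim_col (A_shift j 0) = 0"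
  by (induction j) (auto simp: Let_def)

text \<open>Reassociating the iterated join splits off its leftmost block; the remaining blocks are
  those of the same matrix for \<open>k\<close>.\<close>

lemma A_shift_Suc_Suc:
  "A_shift (Suc j) (Suc k) =
    (A_shift j (Suc k) @\<^sub>r 1\<^sub>m ((Suc k + j) choose Suc j)) \<squnion> A_shift (Suc j) k"
proof -
  define B where "B = (\<lambda>i. A_shift j i @\<^sub>r 1\<^sub>m ((i + j) choose (j + 1)))"
  have A: "A_shift (Suc j) i = foldl (\<squnion>) (B i) (map B (rev [1..<i]))" for i
    by (simp add: B_def Let_def)
  \<comment> \<open>\<open>B i\<close> has \<open>(i + j + 1) choose (j + 1)\<close> rows by
    Pascal's rule, so block heights decrease to the right, as reassociation demands.\<close>
  have B: "dim_row (B i) \<le> dim_row (B i')" if "i \<le> i'" for i i'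
    using binomial_right_mono[of "Suc (i + j)" "Suc (i' + j)" "Suc j"] that
    by (simp add: B_def dim_row_A_shift)
  have "A_shift (Suc j) (Suc k) = B (Suc k) \<squnion> A_shift (Suc j) k"
  proof (cases "k = 0")
    case True
    show ?thesis
      unfolding A True
      by (intro eq_matI) (auto simp: B_def bottom_join_def Let_def dim_col_A_shift_0)
  next
    case False
    then have "rev [1..<Suc k] = k # rev [1..<k]" by simp
    then have "A_shift (Suc j) (Suc k) = foldl (\<squnion>) (B (Suc k) \<squnion> B k) (map B (rev [1..<k]))"
      unfolding A by simp
    also have "\<dots> = B (Suc k) \<squnion> A_shift (Suc j) k"
      unfolding A by (intro foldl_bottom_join) (auto intro!: B)
    finally show ?thesis .
  qed
  then show ?thesis by (simp add: B_def)
qed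

text \<open>If row and column both contain \<open>x\<close>, it cancels; if only the row does, the
  entry is 0. If only the column does, equal sizes turn inclusion into equality, giving the
  identity. If neither does, the inclusion is between tuples from \<open>xs\<close>.\<close>

lemma inclusion_mat_Cons:
  fixes x :: "'a::linorder"
  assumes "sorted_wrt (<) (x # xs)"
  shows "inclusion_mat (lex_combs (Suc j) (x # xs)) (lex_combs (Suc (Suc j)) (x # xs)) =
    (inclusion_mat (lex_combs j xs) (lex_combs (Suc j) xs) @\<^sub>r 1\<^sub>m (length xs choose Suc j))
      \<squnion> inclusion_mat (lex_combs (Suc j) xs) (lex_combs (Suc (Suc j)) xs)"
proof -
  define L where "L = (\<lambda>i. lex_combs i xs)"
  have L: "lex_combs i xs = L i" for i by (simp add: L_def)
  have len: "length (L i) = length xs choose i" for i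
    by (simp add: L_def length_lex_combs)
  have mem: "L i ! r \<in> set (L i)" if "r < length xs choose i" for i r
    using that by (simp add: len)
  have x: "x \<notin> set a" if "a \<in> set (L i)" for a i
    using that assms by (auto simp: L_def set_lex_combs)
  have eq: "set (L (Suc j) ! r) \<subseteq> insert x (set (L (Suc j) ! c)) \<longleftrightarrow> r = c"
    if "r < length xs choose Suc j" "c < length xs choose Suc j" for r c
  proof
    let ?a = "L (Suc j) ! r" and ?b = "L (Suc j) ! c"
    assume "set ?a \<subseteq> insert x (set ?b)"
    then have sub: "set ?a \<subseteq> set ?b" using x[OF mem[OF that(1)]] by auto
    have sorted: "sorted_wrt (<) ?a" "sorted_wrt (<) ?b" and "length ?a = length ?b"
      using mem that assms by (auto simp: L_def set_lex_combs)
    then have "card (set ?a) = card (set ?b)"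
      by (simp add: distinct_card strict_sorted_iff)
    with sub have "set ?a = set ?b" by (simp add: card_subset_eq)
    with sorted have "?a = ?b" by (simp add: strict_sorted_equal)
    moreover have "distinct (L (Suc j))"
      using sorted_lex_combs[of xs "Suc j"] assms by (simp add: L_def strict_sorted_iff)
    ultimately show "r = c" using that by (simp add: nth_eq_iff_index_eq len)
  qed auto
  \<comment> \<open>\<open>p\<close> rows and \<open>q\<close> columns contain \<open>x\<close>;
    \<open>q\<close> rows and \<open>s\<close> columns avoid it.\<close>
  define p q s where "p = (length xs choose j)" and "q = (length xs choose Suc j)"
    and "s = (length xs choose Suc (Suc j))"
  have entry: "(if set ((map ((#) x) (L j) @ L (Suc j)) ! r)
        \<subseteq> set ((map ((#) x) (L (Suc j)) @ L (Suc (Suc j))) ! c) then 1 else 0) =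
      ((inclusion_mat (L j) (L (Suc j)) @\<^sub>r 1\<^sub>m q) \<squnion>
        inclusion_mat (L (Suc j)) (L (Suc (Suc j)))) $$ (r, c)"
    (is "?lhs = ?rhs") if rc: "r < p + q" "c < q + s" for r c
  proof (cases "r < p"; cases "c < q")
    assume *: "r < p" "c < q"
    then have "x \<notin> set (L j ! r)" by (auto intro!: x[OF mem] simp: p_def)
    then show ?thesis using *
      by (simp add: bottom_join_def append_rows_def inclusion_mat_def nth_append len
          subset_insert flip: p_def q_def s_def)
  next
    assume *: "r < p" "\<not> c < q"
    then have "x \<notin> set (L (Suc (Suc j)) ! (c - q))"
      using rc by (intro x[OF mem]) (auto simp: s_def)
    then show ?thesis using * rc
      by (simp add: bottom_join_def append_rows_def inclusion_mat_def nth_append len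
          flip: p_def q_def s_def)
  next
    assume *: "\<not> r < p" "c < q"
    then have "set (L (Suc j) ! (r - p)) \<subseteq> insert x (set (L (Suc j) ! c)) \<longleftrightarrow> r - p = c"
      using rc by (intro eq) (auto simp: q_def)
    then show ?thesis using * rc
      by (simp add: bottom_join_def append_rows_def inclusion_mat_def nth_append len
          flip: p_def q_def s_def)
  next
    assume *: "\<not> r < p" "\<not> c < q"
    then show ?thesis using rc
      by (simp add: bottom_join_def append_rows_def inclusion_mat_def nth_append len
          flip: p_def q_def s_def)
  qed
  show ?thesis
    unfolding lex_combs.simps L q_def[symmetric]
  proof (rule eq_matI, goal_cases)
    case (1 r c)
    then have rc: "r < p + q" "c < q + s"
      by (simp_all add: len flip: p_def q_def s_def)
    then show ?case
      unfolding entry[OF rc, symmetric]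
      by (simp add: inclusion_mat_def len flip: p_def q_def s_def)
  qed (simp_all add: len flip: p_def q_def s_def)
qed

text \<open>Deleting the least letter leaves length \<open>k + Suc j = Suc k + j\<close>. The
  shorter list thus fits both blocks of the recursion: \<open>(j, Suc k)\<close> by the outer
  induction and \<open>(Suc j, k)\<close> by the inner one.\<close>

lemma A_shift_eq_inclusion_mat:
  fixes xs :: "'a::linorder list"
  assumes "sorted_wrt (<) xs" "length xs = k + j"
  shows "A_shift j k = inclusion_mat (lex_combs j xs) (lex_combs (Suc j) xs)"
  using assms
proof (induction j arbitrary: k xs)
  case 0
  then show ?case
    by (intro eq_matI) (auto simp: inclusion_mat_def length_lex_combs)
next
  case (Suc j)
  note IH = Suc.IH
  show ?case using Suc.prems
  proof (induction k arbitrary: xs)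
    case 0
    show ?case using 0
      by (intro eq_matI)
        (auto simp: inclusion_mat_def length_lex_combs dim_row_A_shift dim_col_A_shift_0 binomial_eq_0
          simp del: A_shift.simps binomial_Suc_Suc)
  next
    case (Suc k)
    obtain x ys where xs: "xs = x # ys" using Suc.prems by (cases xs) auto
    then have ys: "sorted_wrt (<) ys" "length ys = k + Suc j" using Suc.prems by auto
    show ?case
      using inclusion_mat_Cons[of x ys j] IH[of ys "Suc k"] Suc.IH[OF ys] ys Suc.prems
      by (simp add: A_shift_Suc_Suc xs del: A_shift.simps lex_combs.simps)
  qed
qed

section \<open>Points and index tuples\<close>

lemma fst_pt [simp]: "fst (pt m i) = i"
  by (simp add: pt_def)

lemma inj_pt: "inj (pt m)"
  by (rule inj_on_inverseI[of _ fst]) simp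

lemma map_fst_map_pt [simp]: "map fst (map (pt m) \<alpha>) = \<alpha>"
  by (simp add: o_def)

text \<open>\<open>fst\<close> inverts \<open>pt m\<close>. The index set \<open>N\<close> is
  general to cover both \<open>Sig m\<close> and \<open>Sig_seg s m\<close>.\<close>

lemma combs_pt:
  "combs s (pt m ` N) = map (pt m) ` {\<alpha>. length \<alpha> = s \<and> set \<alpha> \<subseteq> N \<and> sorted_wrt (<) \<alpha>}"
  (is "?L = ?R")
proof (intro subset_antisym subsetI)
  fix t assume t: "t \<in> ?L"
  then have "map (pt m) (map fst t) = t"
    by (auto simp: combs_def intro!: map_idI)
  moreover have "set (map fst t) \<subseteq> N" using t by (auto simp: combs_def)
  ultimately show "t \<in> ?R" using t
    by (intro image_eqI[of _ _ "map fst t"]) (auto simp: combs_def)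
next
  fix t assume "t \<in> ?R"
  then obtain \<alpha> where "t = map (pt m) \<alpha>" "length \<alpha> = s" "set \<alpha> \<subseteq> N" "sorted_wrt (<) \<alpha>"
    by auto
  then show "t \<in> ?L" by (simp add: combs_def image_mono o_def)
qed

lemma combs_Sig: "combs s (Sig m) = map (pt m) ` incr_tuples s m"
  unfolding Sig_def incr_tuples_def by (rule combs_pt)

lemma set_lex_combs_upt: "set (lex_combs l [1..<Suc m]) = incr_tuples l m"
  by (subst set_lex_combs[OF sorted_wrt_upt]) (auto simp: incr_tuples_def)

section \<open>The triangulation as the set of all combinations\<close>

text \<open>Cut a tuple before its last two entries: these leave room only for indices up to
  \<open>m - 2\<close> in front. The bound on \<open>l\<close> makes \<open>last \<alpha>\<close> a
  genuine entry, namely the maximum.\<close>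

lemma combs_eq_UN_T_part:
  assumes "l \<ge> 1"
  shows "combs (l + 2) (Sig m) = (\<Union>\<alpha> \<in> incr_tuples l (m - 2). T_part m \<alpha>)"
proof (intro subset_antisym subsetI)
  fix t assume "t \<in> combs (l + 2) (Sig m)"
  then obtain \<gamma> where t: "t = map (pt m) \<gamma>" and \<gamma>: "\<gamma> \<in> incr_tuples (l + 2) m"
    by (auto simp: combs_Sig)
  define \<alpha> where "\<alpha> = take l \<gamma>"
  have "length (drop l \<gamma>) = Suc (Suc 0)" using \<gamma> by (simp add: incr_tuples_def)
  then obtain a b where ab: "drop l \<gamma> = [a, b]"
    by (metis length_0_conv length_Suc_conv)
  have \<gamma>_eq: "\<gamma> = \<alpha> @ [a, b]" by (simp add: \<alpha>_def flip: ab)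
  have len: "length \<alpha> = l" using \<gamma> by (simp add: \<alpha>_def incr_tuples_def)
  have *: "sorted_wrt (<) \<alpha>" "a < b" "b \<le> m" "\<forall>i\<in>set \<alpha>. 1 \<le> i \<and> i < a"
    using \<gamma> by (auto simp: \<gamma>_eq incr_tuples_def sorted_wrt_append)
  have "last \<alpha> \<in> set \<alpha>" using len assms by (intro last_in_set) auto
  with * have "last \<alpha> < a" by auto
  then have "map (pt m) [a, b] \<in> combs 2 (Sig_seg (last \<alpha>) m)"
    unfolding Sig_seg_def combs_pt using * by (intro imageI) auto
  moreover have "\<alpha> \<in> incr_tuples l (m - 2)"
    using * len by (fastforce simp: incr_tuples_def)
  ultimately show "t \<in> (\<Union>\<alpha> \<in> incr_tuples l (m - 2). T_part m \<alpha>)"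
    by (auto simp: T_part_def t \<gamma>_eq)
next
  fix t assume "t \<in> (\<Union>\<alpha> \<in> incr_tuples l (m - 2). T_part m \<alpha>)"
  then obtain \<alpha> \<gamma> where t: "t = map (pt m) (\<alpha> @ \<gamma>)" and \<alpha>: "\<alpha> \<in> incr_tuples l (m - 2)"
    and \<gamma>: "length \<gamma> = 2" "set \<gamma> \<subseteq> {last \<alpha> + 1..m}" "sorted_wrt (<) \<gamma>"
    by (auto simp: T_part_def Sig_seg_def combs_pt)
  have "i \<le> last \<alpha>" if "i \<in> set \<alpha>" for i
    using \<alpha> that by (cases \<alpha> rule: rev_cases) (auto simp: incr_tuples_def sorted_wrt_append)
  then have "\<forall>i\<in>set \<alpha>. \<forall>j\<in>set \<gamma>. i < j" using \<gamma>(2) by fastforce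
  then have "\<alpha> @ \<gamma> \<in> incr_tuples (l + 2) m"
    using \<alpha> \<gamma> by (fastforce simp: incr_tuples_def sorted_wrt_append)
  then show "t \<in> combs (l + 2) (Sig m)" unfolding combs_Sig t by (rule imageI)
qed

lemma Tbar_eq_combs:
  assumes "even m" "m \<ge> 2"
  shows "Tbar m = combs ((m - 2) div 2) (Sig m)"
proof (cases "m \<ge> 8")
  case True
  then have "(m - 2) div 2 = (m - 6) div 2 + 2" "(m - 6) div 2 \<ge> 1" by presburger+
  then show ?thesis
    using True combs_eq_UN_T_part[of "(m - 6) div 2" m] by (simp add: Tbar_def T_union_def)
next
  case False
  with assms have "m = 2 \<or> m = 4 \<or> m = 6" by presburger
  then show ?thesis by (auto simp: Tbar_def)
qed

section \<open>Supports and the incidence matrix\<close>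

lemma card_supp_map_pt:
  assumes "distinct \<beta>" "set \<beta> \<subseteq> {1..m}"
  shows "card (supp (map (pt m) \<beta>)) = 2 * length \<beta>"
proof -
  have "supp (map (pt m) \<beta>) = set \<beta> \<union> (\<lambda>i. 2 * m - i + 1) ` set \<beta>"
    by (auto simp: supp_def pt_def image_image)
  also have "card \<dots> = card (set \<beta>) + card ((\<lambda>i. 2 * m - i + 1) ` set \<beta>)"
  proof (rule card_Un_disjoint)
    have "i \<le> m" "m < 2 * m - i + 1" if "i \<in> set \<beta>" for i
      using assms(2) that by fastforce+
    then show "set \<beta> \<inter> (\<lambda>i. 2 * m - i + 1) ` set \<beta> = {}" by fastforce
  qed auto
  also have "card ((\<lambda>i. 2 * m - i + 1) ` set \<beta>) = card (set \<beta>)"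
    using assms(2) by (intro card_image inj_onI) fastforce
  finally show ?thesis using assms(1) by (simp add: distinct_card)
qed

lemma phi_map_pt:
  assumes "\<alpha> \<in> incr_tuples j m" "\<beta> \<in> incr_tuples (Suc j) m" "m = 2 * Suc j"
  shows "phi m (map (pt m) \<alpha>) \<beta> = (if set \<alpha> \<subseteq> set \<beta> then 1 else 0)"
proof -
  have \<alpha>: "distinct \<alpha>" "length \<alpha> = j"
    and \<beta>: "distinct \<beta>" "length \<beta> = Suc j" "set \<beta> \<subseteq> {1..m}"
    using assms(1,2) by (auto simp: incr_tuples_def strict_sorted_iff)
  have "(\<exists>p\<in>Sig m. mset (map (pt m) \<beta>) = mset (map (pt m) \<alpha> @ [p]) \<and>
      card (supp (map (pt m) \<alpha> @ [p])) = m) \<longleftrightarrow> set \<alpha> \<subseteq> set \<beta>" (is "?L \<longleftrightarrow> _")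
  proof
    assume ?L
    then obtain i where "mset (map (pt m) \<beta>) = mset (map (pt m) (\<alpha> @ [i]))"
      by (auto simp: Sig_def)
    then have "set (map (pt m) \<beta>) = set (map (pt m) (\<alpha> @ [i]))" by (rule mset_eq_setD)
    then show "set \<alpha> \<subseteq> set \<beta>" using inj_image_subset_iff[OF inj_pt, of m "set \<alpha>" "set \<beta>"] by auto
  next
    assume sub: "set \<alpha> \<subseteq> set \<beta>"
    \<comment> \<open>The point to add is the one index of \<open>\<beta>\<close> missing from
      \<open>\<alpha>\<close>; being new, it brings the support to \<open>2 * Suc j = m\<close>
      elements.\<close>
    have "card (set \<beta> - set \<alpha>) = 1"
      using sub \<alpha> \<beta> by (simp add: card_Diff_subset distinct_card)
    then obtain i where i: "set \<beta> - set \<alpha> = {i}" by (auto simp: card_1_singleton_iff)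
    then have d: "distinct (\<alpha> @ [i])" and s: "set (\<alpha> @ [i]) = set \<beta>" using \<alpha> sub by auto
    then have "mset \<beta> = mset (\<alpha> @ [i])"
      using \<beta> set_eq_iff_mset_eq_distinct by metis
    then have "mset (map (pt m) \<beta>) = mset (map (pt m) (\<alpha> @ [i]))" by (simp only: mset_map)
    moreover have "card (supp (map (pt m) (\<alpha> @ [i]))) = m"
      using d s \<alpha> \<beta> assms(3) by (subst card_supp_map_pt) auto
    moreover have "i \<in> {1..m}" using i \<beta> by auto
    ultimately show ?L by (intro bexI[of _ "pt m i"]) (auto simp: Sig_def)
  qed
  then show ?thesis by (simp add: phi_def)
qed

lemma incidence_matrix_combs:
  assumes "m = 2 * Suc j"
  shows "incidence_matrix m (combs j (Sig m)) =
    inclusion_mat (lex_combs j [1..<Suc m]) (lex_combs (Suc j) [1..<Suc m])"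
proof -
  let ?L = "\<lambda>l. lex_combs l [1..<Suc m]"
  have sorted: "sorted_wrt (<) (?L l)" for l
    by (intro sorted_lex_combs sorted_wrt_upt)
  have cols: "sorted_list_of_set (incr_tuples l m) = ?L l" for l
    unfolding set_lex_combs_upt[symmetric] using sorted
    by (intro sorted_list_of_set.idem_if_sorted_distinct) (auto simp: strict_sorted_iff)
  \<comment> \<open>The sorting key \<open>map fst\<close> recovers the index tuples, so rows
    inherit the order of \<open>lex_combs\<close>.\<close>
  have "sorted_wrt (<) (map (map fst) (map (map (pt m)) (?L j)))"
    using sorted[of j] by (simp add: o_def del: upt_Suc)
  from sorted_key_list_of_set_eq[OF this]
  have rows: "sorted_key_list_of_set (map fst) (combs j (Sig m)) = map (map (pt m)) (?L j)"
    by (simp only: combs_Sig set_lex_combs_upt set_map)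
  have "?L l ! r \<in> incr_tuples l m" if "r < length (?L l)" for l r
    using that unfolding set_lex_combs_upt[symmetric] by (rule nth_mem)
  then have "phi m (map (pt m) (?L j ! r)) (?L (Suc j) ! c) =
      (if set (?L j ! r) \<subseteq> set (?L (Suc j) ! c) then 1 else 0)"
    if "r < length (?L j)" "c < length (?L (Suc j))" for r c
    using that assms by (intro phi_map_pt)
  moreover have "m div 2 = Suc j" using assms by simp
  ultimately show ?thesis
    unfolding incidence_matrix_def Let_def rows inclusion_mat_def
    by (intro eq_matI) (simp_all add: cols del: upt_Suc One_nat_def)
qed

theorem theorem5p7:
  fixes m k :: nat
  assumes "even m" and "m \<ge> 2" and "k = (m + 2) div 2"
  shows "combs ((m - 2) div 2) (Sig m) = Tbar m \<and> L_mat k = A_mat k (int k - 3)"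
proof
  show T: "combs ((m - 2) div 2) (Sig m) = Tbar m"
    using assms Tbar_eq_combs by simp
  define j where "j = (m - 2) div 2"
  have m: "m = 2 * Suc j" and k: "k = j + 2" "2 * k - 2 = m"
    using assms unfolding j_def by presburger+
  have "L_mat k = incidence_matrix m (combs j (Sig m))"
    unfolding L_mat_def k(2) T[symmetric] j_def ..
  also have "\<dots> = inclusion_mat (lex_combs j [1..<Suc m]) (lex_combs (Suc j) [1..<Suc m])"
    using m by (rule incidence_matrix_combs)
  \<comment> \<open>The list \<open>[1..<Suc m]\<close> has length
    \<open>m = 2 * j + 2 = k + j\<close>.\<close>
  also have "\<dots> = A_shift j k"
    using m k by (intro A_shift_eq_inclusion_mat[symmetric] sorted_wrt_upt) simp
  \<comment> \<open>The shifted index is \<open>nat (int k - 2) = j\<close>; for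
    \<open>m = 2\<close> the upper index is -1 and \<open>j = 0\<close>.\<close>
  also have "\<dots> = A_mat k (int k - 3)"
    using k by (simp add: A_mat_def)
  finally show "L_mat k = A_mat k (int k - 3)" .
qed

end
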